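(* Not every faithfully coarsely computable equivalence structure has a faithfully generically computable copy; that is, there is a faithfully coarsely computable equivalence structure $(\omega,E)$ such that no equivalence structure $(\omega,E')$ isomorphic to $(\omega,E)$ is faithfully generically computable.
   Context: A set $S\subseteq\omega$ has asymptotic density $\delta$ if $\lim_{n\to\infty} |S\cap\{0,\dots,n\}|/(n+1)=\delta$. For an equivalence relation $R$ on $\omega$, a set $A$ is $R$-faithful if it is a union of $R$-classes. An equivalence structure $(\omega,E)$ is faithfully coarsely computable if there are a computable equivalence relation $R$ on $\omega$ and a set $A$ of asymptotic density one that is both $E$-faithful and $R$-faithful, such that for all $a,b\in A$, $aRb\iff aEb$. An equivalence structure $(\omega,E)$ is faithfully generically computable if there are a partial computable function $\Phi:\omega^2\to\{0,1\}$ with $\Phi=\chi_E$ (the characteristic function of $E$) on the domain of $\Phi$, and an $E$-faithful computably enumerable set $A$ of asymptotic density 1 with $A\times A\subseteq\mathrm{Dom}(\Phi)$. *)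

theory Defs
  imports Complex_Main
begin

text \<open>
  Kleene's partial recursive functions, given by programs. Programs carry no arity annotation:
  the length of the argument list is the arity, and a program is undefined on a list that is
  too short for it. At each fixed arity the programs compute exactly
  the partial recursive functions of that arity.
\<close>

datatype recf =
    Zero
  | Succ
  | Proj nat
  | Comp recf "recf list"
  | Prec recf recf
  | Mu recf

inductive computes :: "recf \<Rightarrow> nat list \<Rightarrow> nat \<Rightarrow> bool" where
  computes_Zero: "computes Zero xs 0"
| computes_Succ: "computes Succ (x # xs) (Suc x)"
| computes_Proj: "i < length xs \<Longrightarrow> computes (Proj i) xs (xs ! i)"
| computes_Comp:
    "list_all2 (\<lambda>g y. computes g xs y) gs ys \<Longrightarrow> computes f ys z \<Longrightarrow> computes (Comp f gs) xs z"
| computes_Prec_0: "computes f xs y \<Longrightarrow> computes (Prec f g) (0 # xs) y"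
| computes_Prec_Suc:
    "computes (Prec f g) (n # xs) r \<Longrightarrow> computes g (n # r # xs) y \<Longrightarrow>
     computes (Prec f g) (Suc n # xs) y"
| computes_Mu:
    "computes f (n # xs) 0 \<Longrightarrow> (\<forall>m<n. \<exists>k. computes f (m # xs) (Suc k)) \<Longrightarrow>
     computes (Mu f) xs n"

lemma computes_deterministic: "computes p xs y \<Longrightarrow> computes p xs z \<Longrightarrow> y = z"
proof (induction arbitrary: z rule: computes.induct)
  case (computes_Zero xs)
  then show ?case by cases auto
next
  case (computes_Succ x xs)
  then show ?case by cases auto
next
  case (computes_Proj i xs)
  from computes_Proj.prems show ?case by cases auto
next
  case (computes_Comp xs gs ys f w)
  from computes_Comp.prems obtain ys' where
    ys': "list_all2 (\<lambda>g y. computes g xs y) gs ys'" and z: "computes f ys' z"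
    by cases auto
  have "ys = ys'"
    using computes_Comp.IH(1) ys' by (auto simp: list_all2_conv_all_nth intro!: nth_equalityI)
  with z show ?case using computes_Comp.IH(2) by blast
next
  case (computes_Prec_0 f xs y g)
  from computes_Prec_0.prems show ?case by cases (auto dest: computes_Prec_0.IH)
next
  case (computes_Prec_Suc f g n xs r y)
  from computes_Prec_Suc.prems obtain r' where
    "computes (Prec f g) (n # xs) r'" "computes g (n # r' # xs) z"
    by cases auto
  then show ?case using computes_Prec_Suc.IH by blast
next
  case (computes_Mu f n xs)
  from computes_Mu.prems have z: "computes f (z # xs) 0"
      and less: "\<forall>m<z. \<exists>k. computes f (m # xs) (Suc k)"
    by (cases; auto)+
  show ?case
  proof (cases n z rule: linorder_cases)
    case less
    then obtain k where "computes f (n # xs) (Suc k)"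
      using \<open>\<forall>m<z. \<exists>k. computes f (m # xs) (Suc k)\<close> by blast
    then show ?thesis using computes_Mu.IH(1) by blast
  next
    case greater
    then show ?thesis using computes_Mu.IH(2) z by fastforce
  qed
qed

definition partial_computable2 :: "(nat \<Rightarrow> nat \<Rightarrow> nat option) \<Rightarrow> bool" where
  "partial_computable2 \<Phi> \<longleftrightarrow> (\<exists>p. \<forall>x y v. \<Phi> x y = Some v \<longleftrightarrow> computes p [x, y] v)"

definition chi :: "(nat \<times> nat) set \<Rightarrow> nat \<Rightarrow> nat \<Rightarrow> nat" where
  "chi E x y = (if (x, y) \<in> E then 1 else 0)"

definition computable_rel :: "(nat \<times> nat) set \<Rightarrow> bool" where
  "computable_rel R \<longleftrightarrow> partial_computable2 (\<lambda>x y. Some (chi R x y))"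

definition computably_enumerable :: "nat set \<Rightarrow> bool" where
  "computably_enumerable A \<longleftrightarrow> (\<exists>p. A = {x. \<exists>v. computes p [x] v})"

definition has_asymptotic_density :: "nat set \<Rightarrow> real \<Rightarrow> bool" where
  "has_asymptotic_density S \<delta> \<longleftrightarrow>
     (\<lambda>n. real (card (S \<inter> {0..n})) / real (n + 1)) \<longlonglongrightarrow> \<delta>"

definition faithful :: "(nat \<times> nat) set \<Rightarrow> nat set \<Rightarrow> bool" where
  "faithful R A \<longleftrightarrow> (\<exists>C. C \<subseteq> UNIV // R \<and> A = \<Union>C)"

text \<open>An equivalence structure on the natural numbers is represented by its relation \<open>E\<close>;
  that \<open>E\<close> is an equivalence relation is a separate hypothesis \<open>equiv UNIV E\<close>.\<close>

definition faithfully_coarsely_computable :: "(nat \<times> nat) set \<Rightarrow> bool" where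
  "faithfully_coarsely_computable E \<longleftrightarrow>
     (\<exists>R A. equiv UNIV R \<and> computable_rel R \<and>
            has_asymptotic_density A 1 \<and> faithful E A \<and> faithful R A \<and>
            (\<forall>a\<in>A. \<forall>b\<in>A. (a, b) \<in> R \<longleftrightarrow> (a, b) \<in> E))"

definition faithfully_generically_computable :: "(nat \<times> nat) set \<Rightarrow> bool" where
  "faithfully_generically_computable E \<longleftrightarrow>
     (\<exists>\<Phi> A. partial_computable2 \<Phi> \<and>
            (\<forall>x y v. \<Phi> x y = Some v \<longrightarrow> v = chi E x y) \<and>
            faithful E A \<and> computably_enumerable A \<and> has_asymptotic_density A 1 \<and>
            A \<times> A \<subseteq> {(x, y). \<Phi> x y \<noteq> None})"

definition isomorphic_structures :: "(nat \<times> nat) set \<Rightarrow> (nat \<times> nat) set \<Rightarrow> bool" where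
  "isomorphic_structures E E' \<longleftrightarrow>
     (\<exists>f. bij f \<and> (\<forall>x y. (x, y) \<in> E \<longleftrightarrow> (f x, f y) \<in> E'))"

end

theory Submission
  imports Defs "HOL-Library.Countable" "HOL-Library.Nat_Bijection" "HOL-Real_Asymp.Real_Asymp"
begin

text \<open>
  The idea is a counting argument. Suppose a copy \<open>E'\<close> of \<open>E\<close> is faithfully generically
  computable through programs \<open>p\<close> (for the partial characteristic function) and \<open>q\<close> (for the
  enumerable set \<open>A\<close>). As \<open>A\<close> is closed under \<open>E'\<close>, the sizes of the \<open>E'\<close>-classes inside \<open>A\<close>
  can be read off from \<open>p\<close> and \<open>q\<close> alone; call this set of sizes \<open>observed_sizes p q\<close>. If \<open>E\<close> has
  only finite classes, and only finitely many of each size, then \<open>observed_sizes p q\<close> is infinite,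
  because \<open>A\<close> is. Moreover it consists of sizes of \<open>E\<close>-classes. There are only countably many
  pairs of programs, so it suffices that the class sizes of \<open>E\<close> avoid a set \<open>Y\<close> that meets every
  infinite set of the form \<open>observed_sizes p q\<close>.

  The set \<open>Y\<close> can be chosen as sparse as desired (\<open>sparse_hitting_set\<close>), and this keeps \<open>E\<close> close
  to a computable relation. Identify \<open>\<omega>\<close> with pairs of numbers by Cantor's pairing function, and let
  \<open>R\<close> have the antidiagonals as its classes, one class of each positive size. The relation \<open>E\<close> is
  obtained from \<open>R\<close> by cutting every class whose size lies in \<open>Y\<close> into two halves. If the elements of
  \<open>Y\<close> more than double at each step, a half of an element of \<open>Y\<close> is not in \<open>Y\<close>
  (\<open>card_class_notin\<close>), so the class sizes of \<open>E\<close> avoid \<open>Y\<close>; and the antidiagonals that have been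
  cut contain at most \<open>2 * (sqrt (2 * N) + 1)\<close> of the numbers up to \<open>N\<close> (\<open>density_uncut\<close>), so \<open>E\<close>
  and \<open>R\<close> agree on a faithful set of density one.
\<close>

section \<open>Faithful sets and kernels\<close>

lemma faithful_iff_closed:
  assumes "equiv UNIV R"
  shows "faithful R A \<longleftrightarrow> (\<forall>x y. (x, y) \<in> R \<longrightarrow> x \<in> A \<longrightarrow> y \<in> A)"
proof
  assume "faithful R A"
  then obtain C where C: "C \<subseteq> UNIV // R" "A = \<Union>C"
    unfolding faithful_def by blast
  show "\<forall>x y. (x, y) \<in> R \<longrightarrow> x \<in> A \<longrightarrow> y \<in> A"
  proof (intro allI impI)
    fix x y assume "(x, y) \<in> R" "x \<in> A"
    then obtain X where X: "X \<in> C" "x \<in> X" using C by blast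
    then have "X \<in> UNIV // R" using C by blast
    then have "y \<in> X"
      using X \<open>(x, y) \<in> R\<close> assms in_quotient_imp_closed by metis
    then show "y \<in> A" using C X by blast
  qed
next
  assume closed: "\<forall>x y. (x, y) \<in> R \<longrightarrow> x \<in> A \<longrightarrow> y \<in> A"
  have "A = \<Union> ((\<lambda>x. R `` {x}) ` A)"
    using closed equiv_class_self[OF assms] by auto
  moreover have "(\<lambda>x. R `` {x}) ` A \<subseteq> UNIV // R"
    by (auto intro: quotientI)
  ultimately show "faithful R A" unfolding faithful_def by metis
qed

lemma equiv_same_value: "equiv UNIV {(a, b). g a = g b}"
  by (auto intro!: equivI simp: refl_on_def sym_def trans_def)

section \<open>Antidiagonals\<close>

definition diag :: "nat \<Rightarrow> nat" where
  "diag a = fst (prod_decode a) + snd (prod_decode a)"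

abbreviation pos :: "nat \<Rightarrow> nat" where
  "pos a \<equiv> fst (prod_decode a)"

lemma triangle_diag: "a = triangle (diag a) + pos a"
proof -
  have "a = prod_encode (pos a, snd (prod_decode a))" by simp
  also have "\<dots> = triangle (diag a) + pos a" by (simp only: prod_encode_def diag_def prod.case)
  finally show ?thesis .
qed

lemma triangle_mono: "m \<le> n \<Longrightarrow> triangle m \<le> triangle n"
  by (induction n rule: dec_induct) auto

lemma diag_le_iff: "diag a \<le> n \<longleftrightarrow> a < triangle (Suc n)"
proof
  assume "diag a \<le> n"
  have "a < triangle (Suc (diag a))"
    using triangle_diag[of a] by (simp add: diag_def)
  also have "\<dots> \<le> triangle (Suc n)"
    using \<open>diag a \<le> n\<close> by (intro triangle_mono) simp
  finally show "a < triangle (Suc n)" .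
next
  assume "a < triangle (Suc n)"
  then have "triangle (diag a) < triangle (Suc n)"
    using triangle_diag[of a] by linarith
  then show "diag a \<le> n"
    using triangle_mono[of "Suc n" "diag a"] by (meson leD not_less_eq_eq)
qed

lemma diag_mono: "a \<le> b \<Longrightarrow> diag a \<le> diag b"
  using diag_le_iff[of a "diag b"] diag_le_iff[of b "diag b"] by linarith

lemma antidiagonal_eq_image:
  "{a. diag a = n \<and> P (pos a)} = (\<lambda>i. prod_encode (i, n - i)) ` {i. i \<le> n \<and> P i}"
proof (intro set_eqI iffI)
  fix a assume "a \<in> {a. diag a = n \<and> P (pos a)}"
  then have n: "n = diag a" and "P (pos a)" by auto
  moreover have "n - pos a = snd (prod_decode a)" unfolding n diag_def by simp
  then have "prod_encode (pos a, n - pos a) = a" by simp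
  moreover have "pos a \<le> n" unfolding n diag_def by simp
  ultimately show "a \<in> (\<lambda>i. prod_encode (i, n - i)) ` {i. i \<le> n \<and> P i}"
    by (metis (mono_tags, lifting) image_eqI mem_Collect_eq)
qed (auto simp: diag_def)

lemma card_antidiagonal: "card {a. diag a = n \<and> P (pos a)} = card {i. i \<le> n \<and> P i}"
  unfolding antidiagonal_eq_image by (intro card_image) (auto simp: inj_on_def)

lemma finite_diag_le: "finite {a. diag a \<le> n}"
  by (simp add: diag_le_iff)

section \<open>Computability of the antidiagonals\<close>

definition prog_add :: recf where
  "prog_add = Prec (Proj 0) (Comp Succ [Proj 1])"

definition prog_pred :: recf where
  "prog_pred = Prec Zero (Proj 0)"

text \<open>Recursion runs on the first argument, so the subtrahend comes first.\<close>

definition prog_rsub :: recf where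
  "prog_rsub = Prec (Proj 0) (Comp prog_pred [Proj 1])"

definition prog_triangle :: recf where
  "prog_triangle = Prec Zero (Comp prog_add [Comp Succ [Proj 0], Proj 1])"

definition prog_diag :: recf where
  "prog_diag = Mu (Comp prog_rsub [Comp prog_triangle [Comp Succ [Proj 0]], Comp Succ [Proj 1]])"

definition prog_same_diag :: recf where
  "prog_same_diag =
     (let d = Comp prog_diag [Proj 0]; e = Comp prog_diag [Proj 1] in
      Comp prog_rsub [Comp prog_add [Comp prog_rsub [d, e], Comp prog_rsub [e, d]],
                      Comp Succ [Zero]])"

lemma computes_Proj_eq: "i < length xs \<Longrightarrow> xs ! i = y \<Longrightarrow> computes (Proj i) xs y"
  using computes_Proj by blast

lemma computes_Comp1:
  "computes g xs y \<Longrightarrow> computes f [y] z \<Longrightarrow> computes (Comp f [g]) xs z"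
  by (rule computes_Comp[where ys = "[y]"]) auto

lemma computes_Comp2:
  "computes g xs y \<Longrightarrow> computes h xs y' \<Longrightarrow> computes f [y, y'] z \<Longrightarrow> computes (Comp f [g, h]) xs z"
  by (rule computes_Comp[where ys = "[y, y']"]) auto

lemma computes_add: "computes prog_add [m, n] (m + n)"
proof (induction m)
  case 0
  show ?case unfolding prog_add_def by (auto intro!: computes_Prec_0 computes_Proj_eq)
next
  case (Suc m)
  show ?case unfolding prog_add_def
    by (rule computes_Prec_Suc[OF Suc[unfolded prog_add_def]])
      (auto intro!: computes_Comp1[where y = "m + n"] computes_Proj_eq computes_Succ)
qed

lemma computes_pred: "computes prog_pred [n] (n - 1)"
proof (induction n)
  case 0
  show ?case unfolding prog_pred_def by (auto intro!: computes_Prec_0 computes_Zero)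
next
  case (Suc n)
  show ?case unfolding prog_pred_def
    by (rule computes_Prec_Suc[OF Suc[unfolded prog_pred_def]]) (auto intro!: computes_Proj_eq)
qed

lemma computes_rsub: "computes prog_rsub [m, n] (n - m)"
proof (induction m)
  case 0
  show ?case unfolding prog_rsub_def by (auto intro!: computes_Prec_0 computes_Proj_eq)
next
  case (Suc m)
  have "computes prog_pred [n - m] (n - Suc m)"
    using computes_pred[of "n - m"] by simp
  then show ?case unfolding prog_rsub_def
    by (intro computes_Prec_Suc[OF Suc[unfolded prog_rsub_def]])
      (auto intro!: computes_Comp1[where y = "n - m"] computes_Proj_eq)
qed

lemma computes_triangle: "computes prog_triangle [n] (triangle n)"
proof (induction n)
  case 0
  show ?case unfolding prog_triangle_def by (auto intro!: computes_Prec_0 computes_Zero)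
next
  case (Suc n)
  have "computes prog_add [Suc n, triangle n] (triangle (Suc n))"
    using computes_add[of "Suc n" "triangle n"] by (simp add: add.commute)
  then show ?case unfolding prog_triangle_def
    by (intro computes_Prec_Suc[OF Suc[unfolded prog_triangle_def]])
      (auto intro!: computes_Comp2[where y = "Suc n" and y' = "triangle n"]
        computes_Comp1[where y = n] computes_Proj_eq computes_Succ)
qed

text \<open>By \<open>diag_le_iff\<close>, \<open>diag a\<close> is the least \<open>n\<close> with \<open>Suc a - triangle (Suc n) = 0\<close>, hence is
  found by unbounded search.\<close>

lemma computes_diag: "computes prog_diag [a] (diag a)"
proof -
  let ?f = "Comp prog_rsub [Comp prog_triangle [Comp Succ [Proj 0]], Comp Succ [Proj 1]]"
  have f: "computes ?f [n, a] (Suc a - triangle (Suc n))" for n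
    by (rule computes_Comp2[OF _ _ computes_rsub])
      (auto simp del: triangle_Suc intro!: computes_Comp1[OF _ computes_triangle]
        computes_Comp1[OF _ computes_Succ] computes_Proj_eq)
  have "Suc a - triangle (Suc (diag a)) = 0"
    using diag_le_iff[of a "diag a"] by simp
  then have "computes ?f [diag a, a] 0"
    using f[of "diag a"] by metis
  moreover have "\<exists>k. computes ?f [m, a] (Suc k)" if "m < diag a" for m
  proof -
    have "Suc a - triangle (Suc m) = Suc (a - triangle (Suc m))"
      using diag_le_iff[of a m] that by (simp del: triangle_Suc add: Suc_diff_le)
    then show ?thesis using f[of m] by metis
  qed
  ultimately show ?thesis
    unfolding prog_diag_def by (intro computes_Mu) auto
qed

lemma computes_same_diag:
  "computes prog_same_diag [a, b] (1 - ((diag b - diag a) + (diag a - diag b)))"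
proof -
  have d: "computes (Comp prog_diag [Proj 0]) [a, b] (diag a)"
    by (rule computes_Comp1[OF _ computes_diag]) (auto intro!: computes_Proj_eq)
  have e: "computes (Comp prog_diag [Proj 1]) [a, b] (diag b)"
    by (rule computes_Comp1[OF _ computes_diag]) (auto intro!: computes_Proj_eq)
  have one: "computes (Comp Succ [Zero]) [a, b] 1"
    using computes_Comp1[OF computes_Zero computes_Succ] by simp
  show ?thesis
    unfolding prog_same_diag_def Let_def
    by (intro computes_Comp2[OF computes_Comp2[OF _ _ computes_add] one computes_rsub]
        computes_Comp2[OF _ _ computes_rsub] d e)
qed

lemma computable_same_diag: "computable_rel {(a, b). diag a = diag b}"
proof -
  have "computes prog_same_diag [x, y] (chi {(a, b). diag a = diag b} x y)" for x y
    using computes_same_diag[of x y] by (auto simp: chi_def split: if_splits)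
  then show ?thesis
    unfolding computable_rel_def partial_computable2_def
    using computes_deterministic by (metis option.inject)
qed

section \<open>Sparse sets of sizes\<close>

text \<open>The bound \<open>2 \<le> y\<close> makes both halves of an element smaller than the element itself; the
  \<open>+ 1\<close> keeps also the half that is rounded down out of \<open>Y\<close>.\<close>

definition sparse :: "nat set \<Rightarrow> bool" where
  "sparse Y \<longleftrightarrow> (\<forall>y\<in>Y. 2 \<le> y) \<and> (\<forall>y\<in>Y. \<forall>z\<in>Y. y < z \<longrightarrow> 2 * y + 1 < z)"

text \<open>Infinitude of each \<open>S n\<close> leaves room to choose its representative far above the previous
  ones.\<close>

lemma sparse_hitting_set:
  fixes S :: "nat \<Rightarrow> nat set"
  assumes inf: "\<And>n. infinite (S n)"
  obtains Y where "sparse Y" "\<And>n. Y \<inter> S n \<noteq> {}"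
proof -
  have large: "\<exists>y. (y \<in> S n \<and> 2 \<le> y) \<and> m < y" for m n
  proof -
    obtain y where "max m 2 < y" "y \<in> S n"
      using inf[of n] unfolding finite_nat_set_iff_bounded_le by (metis not_le)
    then show ?thesis by auto
  qed
  have "\<exists>y. \<forall>n. (y n \<in> S n \<and> 2 \<le> y n) \<and> 2 * y n + 1 < y (Suc n)"
    using large by (intro dependent_nat_choice) blast+
  then obtain y where y: "\<And>n. y n \<in> S n" "\<And>n. 2 \<le> y n" "\<And>n. 2 * y n + 1 < y (Suc n)"
    by blast
  have less: "2 * y i + 1 < y j" if "i < j" for i j
    using that
  proof (induction j rule: less_Suc_induct)
    case (1 i)
    show ?case by (rule y(3))
  next
    case (2 i j k)
    then show ?case by linarith
  qed
  have "sparse (range y)"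
    unfolding sparse_def
  proof (intro conjI ballI impI)
    fix u v assume "u \<in> range y" "v \<in> range y" "u < v"
    then obtain i j where ij: "u = y i" "v = y j" by blast
    then have "i < j"
      using \<open>u < v\<close> less[of j i] by (metis add_lessD1 less_asym' linorder_less_linear mult_2)
    then show "2 * u + 1 < v" using less ij by simp
  qed (use y in auto)
  moreover have "range y \<inter> S n \<noteq> {}" for n using y(1) by blast
  ultimately show thesis by (rule that)
qed

text \<open>A geometric sum: if \<open>m\<close> is the largest element of \<open>Y\<close> up to \<open>M\<close>, the others
  are below \<open>m / 2\<close>.\<close>

lemma sum_sparse_le:
  assumes "sparse Y"
  shows "\<Sum>(Y \<inter> {..M}) \<le> 2 * M"
proof (induction M rule: less_induct)
  case (less M)
  show ?case
  proof (cases "Y \<inter> {..M} = {}")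
    case False
    define m where "m = Max (Y \<inter> {..M})"
    have m: "m \<in> Y" "m \<le> M"
      using Max_in[of "Y \<inter> {..M}"] False by (auto simp: m_def)
    then have "2 \<le> m" using assms by (auto simp: sparse_def)
    have "z \<in> insert m (Y \<inter> {..m div 2})" if "z \<in> Y \<inter> {..M}" for z
    proof (cases "z = m")
      case False
      moreover have "z \<le> m" using that unfolding m_def by (intro Max_ge) auto
      ultimately have "z < m" by simp
      then have "2 * z + 1 < m" using assms m(1) that by (auto simp: sparse_def)
      then show ?thesis using that by auto
    qed simp
    then have "\<Sum>(Y \<inter> {..M}) \<le> \<Sum>(insert m (Y \<inter> {..m div 2}))"
      by (intro sum_mono2) auto
    also have "\<dots> = m + \<Sum>(Y \<inter> {..m div 2})"
      using \<open>2 \<le> m\<close> by (subst sum.insert) auto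
    also have "\<dots> \<le> m + 2 * (m div 2)"
      using less[of "m div 2"] \<open>2 \<le> m\<close> m(2) by simp
    also have "\<dots> \<le> 2 * M" using m(2) by simp
    finally show ?thesis .
  qed simp
qed

section \<open>Cutting the antidiagonals with size in a sparse set\<close>

definition colour :: "nat set \<Rightarrow> nat \<Rightarrow> nat \<times> bool" where
  "colour Y a = (diag a, Suc (diag a) \<in> Y \<and> pos a < Suc (diag a) div 2)"

definition cut_rel :: "nat set \<Rightarrow> (nat \<times> nat) set" where
  "cut_rel Y = {(a, b). colour Y a = colour Y b}"

lemma equiv_cut_rel: "equiv UNIV (cut_rel Y)"
  unfolding cut_rel_def by (rule equiv_same_value)

text \<open>Here \<open>s\<close> is the number of elements of the antidiagonal through \<open>a\<close>; within it, the cut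
  separates the positions below \<open>s div 2\<close> from the others.\<close>

lemma card_class_cases:
  fixes Y a defines "s \<equiv> Suc (diag a)"
  shows "card (cut_rel Y `` {a}) = s \<and> s \<notin> Y \<or>
         card (cut_rel Y `` {a}) \<in> {s div 2, s - s div 2} \<and> s \<in> Y"
proof (cases "s \<in> Y")
  case False
  have "cut_rel Y `` {a} = {b. diag b = diag a \<and> True}"
    using False by (auto simp: cut_rel_def colour_def s_def)
  then have "card (cut_rel Y `` {a}) = card {i. i \<le> diag a \<and> True}"
    using card_antidiagonal[of "diag a" "\<lambda>_. True"] by simp
  then show ?thesis using False by (simp add: s_def)
next
  case True
  have half: "cut_rel Y `` {a} = {b. diag b = diag a \<and> (pos b < s div 2 \<longleftrightarrow> pos a < s div 2)}"
    using True by (auto simp: cut_rel_def colour_def s_def)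
  have "{i. i \<le> diag a \<and> (i < s div 2 \<longleftrightarrow> pos a < s div 2)} =
        (if pos a < s div 2 then {..<s div 2} else {s div 2..<s})"
    by (auto simp: s_def)
  then show ?thesis
    unfolding half card_antidiagonal[of "diag a" "\<lambda>i. i < s div 2 \<longleftrightarrow> pos a < s div 2"]
    using True by simp
qed

lemma card_class_notin:
  assumes "sparse Y"
  shows "card (cut_rel Y `` {a}) \<notin> Y"
proof
  let ?c = "card (cut_rel Y `` {a})" and ?s = "Suc (diag a)"
  assume c: "?c \<in> Y"
  then have half: "?c \<in> {?s div 2, ?s - ?s div 2}" and s: "?s \<in> Y"
    using card_class_cases[of Y a] by auto
  have "2 \<le> ?s" using s assms by (auto simp: sparse_def)
  with half have "?c < ?s" "?s \<le> 2 * ?c + 1" by auto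
  moreover from this c s assms have "2 * ?c + 1 < ?s" unfolding sparse_def by blast
  ultimately show False by simp
qed

lemma finite_card_class:
  assumes "finite T"
  shows "finite {a. card (cut_rel Y `` {a}) \<in> T}"
proof (rule finite_subset[OF _ finite_diag_le])
  show "{a. card (cut_rel Y `` {a}) \<in> T} \<subseteq> {a. diag a \<le> 2 * Max T}"
  proof
    fix a assume "a \<in> {a. card (cut_rel Y `` {a}) \<in> T}"
    then have "card (cut_rel Y `` {a}) \<le> Max T"
      using assms by simp
    moreover have "diag a \<le> 2 * card (cut_rel Y `` {a})"
      using card_class_cases[of Y a] by auto
    ultimately show "a \<in> {a. diag a \<le> 2 * Max T}" by simp
  qed
qed

lemma density_uncut:
  assumes "sparse Y"
  shows "has_asymptotic_density {a. Suc (diag a) \<notin> Y} 1"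
proof -
  let ?B = "\<lambda>N. {a. Suc (diag a) \<in> Y} \<inter> {0..N}"
  have card_B: "card (?B N) \<le> 2 * Suc (diag N)" for N
  proof -
    have "?B N \<subseteq> (\<Union>y\<in>Y \<inter> {..Suc (diag N)}. {a. Suc (diag a) = y})"
      using diag_mono by auto
    moreover have fin: "finite {a. Suc (diag a) = y}" for y
      by (rule finite_subset[OF _ finite_diag_le[of y]]) auto
    ultimately have "card (?B N) \<le> card (\<Union>y\<in>Y \<inter> {..Suc (diag N)}. {a. Suc (diag a) = y})"
      by (intro card_mono) auto
    also have "\<dots> \<le> (\<Sum>y\<in>Y \<inter> {..Suc (diag N)}. card {a. Suc (diag a) = y})"
      by (rule card_UN_le) simp
    also have "\<dots> = \<Sum>(Y \<inter> {..Suc (diag N)})"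
    proof (intro sum.cong refl)
      fix y assume "y \<in> Y \<inter> {..Suc (diag N)}"
      then have "2 \<le> y" using assms by (auto simp: sparse_def)
      then have "{a. Suc (diag a) = y} = {a. diag a = y - 1 \<and> True}" by auto
      then show "card {a. Suc (diag a) = y} = y"
        using card_antidiagonal[of "y - 1" "\<lambda>_. True"] \<open>2 \<le> y\<close> by simp
    qed
    also have "\<dots> \<le> 2 * Suc (diag N)" by (rule sum_sparse_le[OF assms])
    finally show ?thesis .
  qed
  have diag_sqrt: "real (diag N) \<le> sqrt (2 * real N)" for N
  proof -
    have "2 * triangle (diag N) = diag N * Suc (diag N)"
      by (simp add: triangle_def)
    then have "diag N * diag N \<le> 2 * N"
      using triangle_diag[of N] by simp
    then have "(real (diag N))\<^sup>2 \<le> 2 * real N"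
      by (metis of_nat_le_iff of_nat_mult of_nat_numeral power2_eq_square)
    then show ?thesis by (rule real_le_rsqrt)
  qed
  have ratio: "real (card ({a. Suc (diag a) \<notin> Y} \<inter> {0..N})) / real (N + 1)
      = 1 - real (card (?B N)) / real (N + 1)" for N
  proof -
    have "card ({a. Suc (diag a) \<notin> Y} \<inter> {0..N}) + card (?B N) = card {0..N}"
    proof (subst card_Un_disjoint[symmetric])
      have "{a. Suc (diag a) \<notin> Y} \<inter> {0..N} \<union> ?B N = {0..N}" by blast
      then show "card ({a. Suc (diag a) \<notin> Y} \<inter> {0..N} \<union> ?B N) = card {0..N}" by (rule arg_cong)
    qed auto
    then have "real (card ({a. Suc (diag a) \<notin> Y} \<inter> {0..N})) = real (N + 1) - real (card (?B N))"
      by simp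
    then show ?thesis by (simp add: diff_divide_distrib)
  qed
  have "(\<lambda>N. real (card (?B N)) / real (N + 1)) \<longlonglongrightarrow> 0"
  proof (rule tendsto_sandwich[of "\<lambda>_. 0"])
    show "(\<lambda>N. 2 * (sqrt (2 * real N) + 1) / real (N + 1)) \<longlonglongrightarrow> 0"
      by real_asymp
    have "real (card (?B N)) \<le> 2 * (sqrt (2 * real N) + 1)" for N
    proof -
      have "real (card (?B N)) \<le> real (2 * Suc (diag N))"
        using card_B[of N] by (rule of_nat_mono)
      then show ?thesis using diag_sqrt[of N] by simp
    qed
    then show "\<forall>\<^sub>F N in sequentially.
        real (card (?B N)) / real (N + 1) \<le> 2 * (sqrt (2 * real N) + 1) / real (N + 1)"
      by (intro always_eventually allI divide_right_mono) auto
  qed auto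
  then have "(\<lambda>N. 1 - real (card (?B N)) / real (N + 1)) \<longlonglongrightarrow> 1 - 0"
    by (intro tendsto_intros)
  then show ?thesis
    unfolding has_asymptotic_density_def ratio by simp
qed

lemma coarsely_computable_cut_rel:
  assumes "sparse Y"
  shows "faithfully_coarsely_computable (cut_rel Y)"
proof -
  let ?R = "{(a, b). diag a = diag b}" and ?A = "{a. Suc (diag a) \<notin> Y}"
  have "equiv UNIV ?R" by (rule equiv_same_value)
  moreover have "faithful (cut_rel Y) ?A"
    unfolding faithful_iff_closed[OF equiv_cut_rel] by (auto simp: cut_rel_def colour_def)
  moreover have "faithful ?R ?A"
    unfolding faithful_iff_closed[OF equiv_same_value] by auto
  moreover have "\<forall>a\<in>?A. \<forall>b\<in>?A. (a, b) \<in> ?R \<longleftrightarrow> (a, b) \<in> cut_rel Y"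
    by (auto simp: cut_rel_def colour_def)
  ultimately show ?thesis
    unfolding faithfully_coarsely_computable_def
    using computable_same_diag density_uncut[OF assms] by blast
qed

section \<open>The class sizes seen by a pair of programs\<close>

instance recf :: countable
  by countable_datatype

definition observed_sizes :: "recf \<Rightarrow> recf \<Rightarrow> nat set" where
  "observed_sizes p q =
     (let A = {x. \<exists>v. computes q [x] v} in (\<lambda>x. card {y \<in> A. computes p [x, y] 1}) ` A)"

lemma infinite_density_one:
  assumes "has_asymptotic_density A 1"
  shows "infinite A"
proof
  assume "finite A"
  have "(\<lambda>n. real (card (A \<inter> {0..n})) / real (n + 1)) \<longlonglongrightarrow> 0"
  proof (rule tendsto_sandwich[of "\<lambda>_. 0"])
    show "(\<lambda>n. real (card A) / real (n + 1)) \<longlonglongrightarrow> 0" by real_asymp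
    show "\<forall>\<^sub>F n in sequentially.
        real (card (A \<inter> {0..n})) / real (n + 1) \<le> real (card A) / real (n + 1)"
      using \<open>finite A\<close> by (intro always_eventually allI divide_right_mono) (auto intro: card_mono)
  qed auto
  then show False
    using assms LIMSEQ_unique unfolding has_asymptotic_density_def by fastforce
qed

text \<open>Inside a closed set \<open>A\<close> on which the partial characteristic function is defined, the elements
  of \<open>A\<close> that are declared equivalent to \<open>x\<close> form the whole class of \<open>x\<close>.\<close>

lemma generically_computable_observed:
  assumes "equiv UNIV E" "faithfully_generically_computable E"
  obtains p q A where "infinite A" "observed_sizes p q = (\<lambda>x. card (E `` {x})) ` A"
proof -
  obtain \<Phi> A where \<Phi>: "partial_computable2 \<Phi>" "\<And>x y v. \<Phi> x y = Some v \<Longrightarrow> v = chi E x y"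
      and A: "faithful E A" "computably_enumerable A" "has_asymptotic_density A 1"
      and dom: "A \<times> A \<subseteq> {(x, y). \<Phi> x y \<noteq> None}"
    using assms(2) unfolding faithfully_generically_computable_def by blast
  obtain p where p: "\<And>x y v. \<Phi> x y = Some v \<longleftrightarrow> computes p [x, y] v"
    using \<Phi>(1) unfolding partial_computable2_def by blast
  obtain q where q: "A = {x. \<exists>v. computes q [x] v}"
    using A(2) unfolding computably_enumerable_def by blast
  have closed: "y \<in> A" if "(x, y) \<in> E" "x \<in> A" for x y
    using A(1) that faithful_iff_closed[OF assms(1)] by blast
  have "{y \<in> A. computes p [x, y] 1} = E `` {x}" if x: "x \<in> A" for x
  proof -
    have "computes p [x, y] 1 \<longleftrightarrow> (x, y) \<in> E" if "y \<in> A" for y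
    proof -
      have "(x, y) \<in> A \<times> A" using x that by simp
      then obtain v where v: "\<Phi> x y = Some v" using dom by blast
      then have "v = chi E x y" by (rule \<Phi>(2))
      then show ?thesis
        using v by (auto simp: p[symmetric] chi_def)
    qed
    then show ?thesis using closed x by auto
  qed
  then have "observed_sizes p q = (\<lambda>x. card (E `` {x})) ` A"
    unfolding observed_sizes_def Let_def q[symmetric] by (intro image_cong) auto
  then show thesis using that infinite_density_one[OF A(3)] by blast
qed

lemma card_class_isomorphism:
  assumes "bij f" "\<And>x y. (x, y) \<in> E \<longleftrightarrow> (f x, f y) \<in> E'"
  shows "card (E' `` {f x}) = card (E `` {x})"
proof -
  have "E' `` {f x} = f ` (E `` {x})"
  proof (intro set_eqI iffI)
    fix z assume "z \<in> E' `` {f x}"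
    moreover obtain y where "z = f y" using bij_pointE[OF assms(1)] by metis
    ultimately show "z \<in> f ` (E `` {x})" using assms(2) by auto
  qed (use assms(2) in auto)
  then show ?thesis
    using card_image[OF inj_on_subset[OF bij_is_inj[OF assms(1)] subset_UNIV]] by simp
qed

text \<open>Finite multiplicities force infinitely many sizes to be observed, and each of them is the size
  of some class of \<open>cut_rel Y\<close>.\<close>

lemma generic_copy_observed:
  assumes Y: "sparse Y"
    and E': "equiv UNIV E'" "isomorphic_structures (cut_rel Y) E'"
      "faithfully_generically_computable E'"
  obtains p q where "infinite (observed_sizes p q)" "Y \<inter> observed_sizes p q = {}"
proof -
  obtain p q A where "infinite A" and obs: "observed_sizes p q = (\<lambda>x. card (E' `` {x})) ` A"
    using generically_computable_observed[OF E'(1,3)] by metis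
  obtain f where f: "bij f" "\<And>x y. (x, y) \<in> cut_rel Y \<longleftrightarrow> (f x, f y) \<in> E'"
    using E'(2) unfolding isomorphic_structures_def by blast
  define B where "B = f -` A"
  have "A = f ` B" using f(1) by (simp add: B_def bij_is_surj)
  then have "infinite B" using \<open>infinite A\<close> by auto
  have obs_B: "observed_sizes p q = (\<lambda>a. card (cut_rel Y `` {a})) ` B"
    unfolding obs \<open>A = f ` B\<close> image_image card_class_isomorphism[OF f] ..
  have "infinite (observed_sizes p q)"
  proof
    assume "finite (observed_sizes p q)"
    then have "finite {a. card (cut_rel Y `` {a}) \<in> observed_sizes p q}"
      by (rule finite_card_class)
    moreover have "B \<subseteq> {a. card (cut_rel Y `` {a}) \<in> observed_sizes p q}"
      unfolding obs_B by auto
    ultimately show False using \<open>infinite B\<close> finite_subset by blast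
  qed
  moreover have "Y \<inter> observed_sizes p q = {}"
    using card_class_notin[OF Y] unfolding obs_B by auto
  ultimately show thesis by (rule that)
qed

theorem mainTheorem8:
  shows "\<exists>E :: (nat \<times> nat) set.
           equiv UNIV E \<and> faithfully_coarsely_computable E \<and>
           (\<forall>E'. equiv UNIV E' \<and> isomorphic_structures E E' \<longrightarrow>
                 \<not> faithfully_generically_computable E')"
proof -
  \<comment> \<open>Finite sets of sizes are replaced by \<open>UNIV\<close>, so that every member of the sequence is infinite.\<close>
  define S where "S n = (case from_nat n of (p, q) \<Rightarrow>
    if infinite (observed_sizes p q) then observed_sizes p q else UNIV)" for n
  have "infinite (S n)" for n by (auto simp: S_def split: prod.split)
  then obtain Y where Y: "sparse Y" "\<And>n. Y \<inter> S n \<noteq> {}"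
    using sparse_hitting_set by metis
  have hit: "Y \<inter> observed_sizes p q \<noteq> {}" if "infinite (observed_sizes p q)" for p q
    using Y(2)[of "to_nat (p, q)"] that by (simp add: S_def)
  have "\<not> faithfully_generically_computable E'"
    if "equiv UNIV E'" "isomorphic_structures (cut_rel Y) E'" for E'
    using generic_copy_observed[OF Y(1) that] hit by metis
  then show ?thesis
    using equiv_cut_rel coarsely_computable_cut_rel[OF Y(1)] by blast
qed

end
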